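(* Let $P\subset\mathbb{R}^d$ be a $d$-dimensional convex polytope containing the origin in its interior, and let $U$ be an orthogonal transformation of $\mathbb{R}^d$ with $P=UP^\circ$. Let $H$ be a linear subspace of $\mathbb{R}^d$ such that $UH=H$ and $\mathrm{proj}_H(P)=P\cap H$, where $\mathrm{proj}_H$ is orthogonal projection onto $H$. Then $P\cap H=U|_H\,(P\cap H)^{\circ_H}$, where $U|_H$ is the restriction of $U$ to $H$ and $(\cdot)^{\circ_H}$ is the polar taken within $H$.
   Context: For $A\subseteq\mathbb{R}^d$, the polar is $A^\circ=\{x\in\mathbb{R}^d:\langle x,a\rangle\le 1\text{ for all }a\in A\}$; for $A\subseteq H$, the polar within $H$ is $A^{\circ_H}=\{x\in H:\langle x,a\rangle\le 1\text{ for all }a\in A\}$. An orthogonal transformation is a linear map $U$ with $U^T=U^{-1}$. *)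

theory Defs
  imports "HOL-Analysis.Analysis"
begin

definition polar :: "'a::euclidean_space set \<Rightarrow> 'a set"
  where "polar A = {x. \<forall>a\<in>A. x \<bullet> a \<le> 1}"

definition polar_within :: "'a::euclidean_space set \<Rightarrow> 'a set \<Rightarrow> 'a set"
  where "polar_within H A = {x \<in> H. \<forall>a\<in>A. x \<bullet> a \<le> 1}"

(* Meaningful only if H is a linear subspace; existence and uniqueness are
   established in orth_proj_unique below. *)
definition orth_proj :: "'a::euclidean_space set \<Rightarrow> 'a \<Rightarrow> 'a"
  where "orth_proj H x = (THE y. y \<in> H \<and> (\<forall>z\<in>H. orthogonal (x - y) z))"

lemma orth_proj_unique:
  fixes H :: "'a::euclidean_space set"
  assumes "subspace H"
  shows "\<exists>!y. y \<in> H \<and> (\<forall>z\<in>H. orthogonal (x - y) z)"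
proof -
  obtain y w where y: "y \<in> span H" "\<And>z. z \<in> span H \<Longrightarrow> orthogonal w z" "x = y + w"
    using orthogonal_subspace_decomp_exists[of H x] by metis
  have sp: "span H = H"
    using assms by (simp add: span_eq_iff)
  show ?thesis
  proof (rule ex1I[of _ y])
    show "y \<in> H \<and> (\<forall>z\<in>H. orthogonal (x - y) z)"
      using y sp by auto
  next
    fix y' assume y': "y' \<in> H \<and> (\<forall>z\<in>H. orthogonal (x - y') z)"
    have "y' - y \<in> H"
      using y y' sp assms by (simp add: subspace_diff)
    hence "(x - y') \<bullet> (y' - y) = 0" "(x - y) \<bullet> (y' - y) = 0"
      using y y' sp by (auto simp: orthogonal_def)
    hence "(y' - y) \<bullet> (y' - y) = 0"
      by (simp add: inner_diff_left)
    thus "y' = y" by simp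
  qed
qed

(* The library notion is stated through preservation of the inner product; it agrees
   with the definition of an orthogonal map by U^T = U^(-1). *)
lemma orthogonal_transformation_iff_adjoint:
  fixes U :: "'a::euclidean_space \<Rightarrow> 'a"
  shows "orthogonal_transformation U \<longleftrightarrow> linear U \<and> bij U \<and> adjoint U = inv U"
proof
  assume U: "orthogonal_transformation U"
  hence lin: "linear U" and b: "bij U"
    by (auto simp: orthogonal_transformation_linear orthogonal_transformation_bij)
  have "adjoint U = inv U"
  proof (rule adjoint_unique, intro allI)
    fix x y
    have "U x \<bullet> U (inv U y) = x \<bullet> inv U y"
      using U by (simp add: orthogonal_transformation_def)
    thus "U x \<bullet> y = x \<bullet> inv U y"
      using b by (simp add: bij_is_surj surj_f_inv_f)
  qed
  with lin b show "linear U \<and> bij U \<and> adjoint U = inv U" by simp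
next
  assume U: "linear U \<and> bij U \<and> adjoint U = inv U"
  have "U x \<bullet> U y = x \<bullet> y" for x y
    using U adjoint_works[of U x "U y"]
    by (metis adjoint_clauses(1) bij_is_inj inv_f_f)
  with U show "orthogonal_transformation U"
    by (simp add: orthogonal_transformation_def)
qed

end

theory Submission
  imports Defs
begin

text \<open>Polarity turns projection onto \<open>H\<close> into section by \<open>H\<close>
  (\<open>polar_within_orth_proj\<close>). As the projection of \<open>P\<close> is its section, the
  polar of \<open>P \<inter> H\<close> within \<open>H\<close> is \<open>polar P \<inter> H\<close>;
  the injective map \<open>U\<close>, which fixes \<open>H\<close> as a set, carries this to
  \<open>P \<inter> H\<close>.\<close>

lemma inner_orth_proj:
  assumes "subspace H" and "z \<in> H"
  shows "z \<bullet> orth_proj H x = z \<bullet> x"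
proof -
  have "orthogonal (x - orth_proj H x) z"
    unfolding orth_proj_def using theI'[OF orth_proj_unique[OF assms(1)]] assms(2) by blast
  then show ?thesis
    by (metis orthogonal_def inner_diff_left inner_commute eq_iff_diff_eq_0)
qed

text \<open>A vector of \<open>H\<close> pairs equally with a point and with its projection, so both
  sides impose the same inequalities.\<close>

lemma polar_within_orth_proj:
  assumes "subspace H"
  shows "polar_within H (orth_proj H ` A) = polar A \<inter> H"
  using inner_orth_proj[OF assms] by (auto simp: polar_within_def polar_def)

theorem theorem5p4:
  fixes P H :: "(real ^ 'n) set" and U :: "real ^ 'n \<Rightarrow> real ^ 'n"
  assumes "polytope P"
    and "aff_dim P = int CARD('n)"
    and "0 \<in> interior P"
    and "orthogonal_transformation U"
    and "P = U ` polar P"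
    and "subspace H"
    and "U ` H = H"
    and "orth_proj H ` P = P \<inter> H"
  shows "P \<inter> H = restrict U H ` polar_within H (P \<inter> H)"
proof -
  \<comment> \<open>\<open>restrict\<close> yields \<open>undefined\<close> off \<open>H\<close>,
    which is harmless: the polar within \<open>H\<close> lies in \<open>H\<close>.\<close>
  have "restrict U H ` polar_within H (P \<inter> H) = U ` polar_within H (P \<inter> H)"
    by (rule image_cong) (auto simp: polar_within_def)
  also have "\<dots> = U ` (polar P \<inter> H)"
    using polar_within_orth_proj[OF assms(6), of P] assms(8) by simp
  also have "\<dots> = U ` polar P \<inter> U ` H"
    using orthogonal_transformation_inj[OF assms(4)] by (rule image_Int)
  also have "\<dots> = P \<inter> H"
    using assms(5,7) by simp
  finally show ?thesis by simp
qed

end
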